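(* Let $\mathcal{H}$ be a right quaternionic Hilbert space, let $T\in\mathcal{B}_R(\mathcal{H})$ be normal and let $i\in\mathbb{S}$. Let $E^i$ be the (unique) spectral measure of the normal operator $T_i$ on the complex Hilbert space $\mathcal{H}_i$, defined on the Borel subsets of $\sigma(T_i)\subseteq\mathbb{C}_i$, so that $T_i=\int_{\sigma(T_i)}\lambda\,dE^i_\lambda$. Then for every Borel set $\omega\subseteq\sigma(T_i)$ that is symmetric with respect to the real axis (i.e. $\bar z\in\omega$ whenever $z\in\omega$), the operator $E^i(\omega)$ is right quaternionic linear on $\mathcal{H}$, i.e. $E^i(\omega)\in\mathcal{B}_R(\mathcal{H})$.
   Context: $\mathbb{H}$ denotes the quaternions, $\bar q$ the conjugate of $q$, $\mathbb{S}=\{q\in\mathbb{H}:q^2=-1\}$, $\mathbb{C}_i=\{\alpha+\beta i:\alpha,\beta\in\mathbb{R}\}$. $\mathcal{H}$ is a right quaternionic Hilbert space with scalar product $\langle\cdot,\cdot\rangle$; $\mathcal{B}_R(\mathcal{H})$ is the set of bounded right linear operators on $\mathcal{H}$, and $T$ is normal if $TT^*=T^*T$. For $i\in\mathbb{S}$, $\mathcal{H}_i$ is $\mathcal{H}$ viewed as a complex vector space over $\mathbb{C}_i$ (scalar multiplication = right multiplication by elements of $\mathbb{C}_i$) with inner product $\langle x,y\rangle_i:=\mathrm{Re}(\langle x,y\rangle)-\mathrm{Re}(\langle x,y\rangle i)i$; it is a complex Hilbert space. $T_i$ is the operator $x\mapsto Tx$ on $\mathcal{H}_i$; it is a bounded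 normal operator on $\mathcal{H}_i$ with adjoint $(T^* )_i$. $\sigma(T_i)$ is its usual spectrum in $\mathbb{C}_i$, and $E^i$ its spectral measure from the classical complex spectral theorem. *)

theory Defs
  imports "HOL-Analysis.Analysis"
begin

datatype quat = Quat (qRe: real) (qI: real) (qJ: real) (qK: real)

instantiation quat :: "{zero, one, plus, minus, uminus, times}"
begin
definition "0 = Quat 0 0 0 0"
definition "1 = Quat 1 0 0 0"
definition "p + q = Quat (qRe p + qRe q) (qI p + qI q) (qJ p + qJ q) (qK p + qK q)"
definition "p - q = Quat (qRe p - qRe q) (qI p - qI q) (qJ p - qJ q) (qK p - qK q)"
definition "- p = Quat (- qRe p) (- qI p) (- qJ p) (- qK p)"
definition "p * q = Quat
   (qRe p * qRe q - qI p * qI q - qJ p * qJ q - qK p * qK q)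
   (qRe p * qI q + qI p * qRe q + qJ p * qK q - qK p * qJ q)
   (qRe p * qJ q - qI p * qK q + qJ p * qRe q + qK p * qI q)
   (qRe p * qK q + qI p * qJ q - qJ p * qI q + qK p * qRe q)"
instance ..
end

definition qreal :: "real \<Rightarrow> quat" where "qreal a = Quat a 0 0 0"
definition qcnj :: "quat \<Rightarrow> quat" where "qcnj q = Quat (qRe q) (- qI q) (- qJ q) (- qK q)"

definition qS :: "quat set" where "qS = {q. q * q = - 1}"

definition cplx_to_quat :: "quat \<Rightarrow> complex \<Rightarrow> quat" where
  "cplx_to_quat i z = qreal (Re z) + qreal (Im z) * i"

locale quat_hilbert =
  fixes rmult :: "'h::ab_group_add \<Rightarrow> quat \<Rightarrow> 'h"
    and qinner :: "'h \<Rightarrow> 'h \<Rightarrow> quat"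
  assumes rmult_add_left: "rmult (x + y) q = rmult x q + rmult y q"
    and rmult_add_right: "rmult x (p + q) = rmult x p + rmult x q"
    and rmult_assoc: "rmult x (p * q) = rmult (rmult x p) q"
    and rmult_one: "rmult x 1 = x"
    and qinner_add_right: "qinner x (y + z) = qinner x y + qinner x z"
    and qinner_rmult_right: "qinner x (rmult y q) = qinner x y * q"
    and qinner_herm: "qinner x y = qcnj (qinner y x)"
    and qinner_pos: "qinner x x = qreal (qRe (qinner x x)) \<and> qRe (qinner x x) \<ge> 0"
    and qinner_def: "qinner x x = 0 \<Longrightarrow> x = 0"
    and complete: "(\<forall>e>0. \<exists>N. \<forall>m\<ge>N. \<forall>n\<ge>N.
                      sqrt (qRe (qinner (X m - X n) (X m - X n))) < e)
                   \<Longrightarrow> \<exists>L. (\<lambda>n. sqrt (qRe (qinner (X n - L) (X n - L)))) \<longlonglongrightarrow> 0"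
begin

definition qnorm :: "'h \<Rightarrow> real" where "qnorm x = sqrt (qRe (qinner x x))"

definition bounded_op :: "('h \<Rightarrow> 'h) \<Rightarrow> bool" where
  "bounded_op T \<longleftrightarrow> (\<exists>K. \<forall>x. qnorm (T x) \<le> K * qnorm x)"

definition right_linear :: "('h \<Rightarrow> 'h) \<Rightarrow> bool" where
  "right_linear T \<longleftrightarrow> (\<forall>x y p q. T (rmult x p + rmult y q) = rmult (T x) p + rmult (T y) q)"

definition BR :: "('h \<Rightarrow> 'h) set" where
  "BR = {T. right_linear T \<and> bounded_op T}"

definition is_adjoint :: "('h \<Rightarrow> 'h) \<Rightarrow> ('h \<Rightarrow> 'h) \<Rightarrow> bool" where
  "is_adjoint T S \<longleftrightarrow> (\<forall>x y. qinner (T x) y = qinner x (S y))"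

definition normal_op :: "('h \<Rightarrow> 'h) \<Rightarrow> bool" where
  "normal_op T \<longleftrightarrow> (\<exists>S. is_adjoint T S \<and> T \<circ> S = S \<circ> T)"

text \<open>Scalar multiplication of H_i: right multiplication by elements of C_i,
  with C_i identified with C via alpha + beta i <-> Complex alpha beta.\<close>
definition cmult :: "quat \<Rightarrow> 'h \<Rightarrow> complex \<Rightarrow> 'h" where
  "cmult i x z = rmult x (cplx_to_quat i z)"

definition cinner :: "quat \<Rightarrow> 'h \<Rightarrow> 'h \<Rightarrow> complex" where
  "cinner i x y = Complex (qRe (qinner x y)) (- qRe (qinner x y * i))"

definition clinear :: "quat \<Rightarrow> ('h \<Rightarrow> 'h) \<Rightarrow> bool" where
  "clinear i A \<longleftrightarrow> (\<forall>x y a b. A (cmult i x a + cmult i y b) = cmult i (A x) a + cmult i (A y) b)"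

definition spectrum_i :: "quat \<Rightarrow> ('h \<Rightarrow> 'h) \<Rightarrow> complex set" where
  "spectrum_i i T = {l. \<not> (\<exists>S. bounded_op S \<and>
        (\<forall>x. S (T x - cmult i x l) = x) \<and> (\<forall>x. T (S x) - cmult i (S x) l = x))}"

definition orth_proj_i :: "quat \<Rightarrow> ('h \<Rightarrow> 'h) \<Rightarrow> bool" where
  "orth_proj_i i P \<longleftrightarrow> clinear i P \<and> bounded_op P \<and> P \<circ> P = P \<and>
     (\<forall>x y. cinner i (P x) y = cinner i x (P y))"

definition spec_scalar_measure :: "quat \<Rightarrow> complex set \<Rightarrow> (complex set \<Rightarrow> 'h \<Rightarrow> 'h) \<Rightarrow> 'h \<Rightarrow> complex measure" where
  "spec_scalar_measure i \<sigma> E x =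
     measure_of \<sigma> (sets (restrict_space borel \<sigma>)) (\<lambda>\<omega>. ennreal (Re (cinner i x (E \<omega> x))))"

text \<open>E is a spectral measure (resolution of the identity) on the Borel subsets of
  sigma = sigma(T_i) with T_i = integral of lambda dE(lambda).  The spectral integral is
  understood in the standard weak sense: <x, T x>_i = integral lambda d<x, E x>_i.\<close>
definition spectral_measure_of :: "quat \<Rightarrow> ('h \<Rightarrow> 'h) \<Rightarrow> (complex set \<Rightarrow> 'h \<Rightarrow> 'h) \<Rightarrow> bool" where
  "spectral_measure_of i T E \<longleftrightarrow>
     (let \<sigma> = spectrum_i i T in
       (\<forall>\<omega> \<in> sets (restrict_space borel \<sigma>). orth_proj_i i (E \<omega>)) \<and>
       E {} = (\<lambda>x. 0) \<and> E \<sigma> = id \<and>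
       (\<forall>\<omega>1 \<in> sets (restrict_space borel \<sigma>). \<forall>\<omega>2 \<in> sets (restrict_space borel \<sigma>).
           E (\<omega>1 \<inter> \<omega>2) = E \<omega>1 \<circ> E \<omega>2) \<and>
       (\<forall>A :: nat \<Rightarrow> complex set. (\<forall>n. A n \<in> sets (restrict_space borel \<sigma>)) \<longrightarrow> disjoint_family A \<longrightarrow>
           (\<forall>x. (\<lambda>n. qnorm ((\<Sum>k<n. E (A k) x) - E (\<Union>k. A k) x)) \<longlonglongrightarrow> 0)) \<and>
       (\<forall>x. integrable (spec_scalar_measure i \<sigma> E x) (\<lambda>z. z) \<and>
            cinner i x (T x) = integral\<^sup>L (spec_scalar_measure i \<sigma> E x) (\<lambda>z. z)))"

end

end

theory Submission
  imports Defs
begin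

text \<open>
  Every quaternion is z + w with z in C_i and w anticommuting with i, and E is C_i-linear, so it
  suffices that right multiplication by w intertwines E(A) with E(cnj A). The range of the spectral
  projection of a closed disc with centre c and radius r consists of the vectors x for which
  |(T - c)^n x| grows at most like s^n for every s > r. Since ((T - c) x) w = (T - cnj c)(x w) and
  |x w| = |x| |w|, right multiplication by w maps this range into the one of the conjugate disc;
  taking adjoints gives the intertwining relation for discs. The Borel sets that satisfy the
  relation form a sigma-algebra, and the discs generate all Borel sets.
\<close>

text \<open>The integral representation is available only weakly, as a formula for <x, T x>_i, and
  no functional calculus is at hand. Two facts usually read off from it are therefore rebuilt from
  this quadratic form: that \<open>E\<close> commutes with \<open>T\<close>, and that on the range
  of E(A) the norm of (T - c) x lies between |x| times the infimum and |x| times the supremum of |z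
  - c| over A. The first holds because the form has no cross terms between A and its complement; the
  second comes from numerical range estimates on small pieces of A. The growth criterion expresses
  the range of a disc projection through \<open>T\<close> and the norm alone. Hence it passes
  through every map that turns T - c into T - cnj c and scales norms, which replaces an appeal to
  the uniqueness of the spectral measure. The rates are taken with s > r rather than s = r because
  the norm estimates carry an additive error, arbitrarily small, and the gap s - r absorbs
  it.\<close>

lemmas quat_ops = zero_quat_def one_quat_def plus_quat_def minus_quat_def uminus_quat_def
  times_quat_def qreal_def qcnj_def cplx_to_quat_def

section \<open>Quaternions relative to an imaginary unit, and discs in the plane\<close>

lemma quat_imaginary_unit:
  assumes "i \<in> qS"
  shows "qRe i = 0" "(qI i)\<^sup>2 + (qJ i)\<^sup>2 + (qK i)\<^sup>2 = 1"
proof -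
  obtain a b c d where i: "i = Quat a b c d" by (cases i)
  have eqs: "a * a - b * b - c * c - d * d = -1" "a * b = 0" "a * c = 0" "a * d = 0"
    using assms by (auto simp: qS_def i quat_ops)
  have "a = 0"
  proof (rule ccontr)
    assume "a \<noteq> 0"
    then have "a * a = -1" using eqs by simp
    then show False using zero_le_square[of a] by linarith
  qed
  then show "qRe i = 0" "(qI i)\<^sup>2 + (qJ i)\<^sup>2 + (qK i)\<^sup>2 = 1"
    using eqs by (auto simp: i power2_eq_square)
qed

text \<open>The part in C_i is the orthogonal projection of \<open>q\<close> onto the span of 1 and
  \<open>i\<close>; its second coefficient -Re(q i) is the Euclidean inner product of
  \<open>q\<close> with \<open>i\<close>. The remainder is imaginary and orthogonal to
  \<open>i\<close>, and such quaternions anticommute with \<open>i\<close>.\<close>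

lemma quat_split_anticommuting:
  assumes "i \<in> qS"
  obtains z w where "q = cplx_to_quat i z + w" "qRe w = 0" "w * i = - (i * w)"
proof
  let ?b = "- qRe (q * i)"
  let ?z = "Complex (qRe q) ?b"
  let ?w = "q - cplx_to_quat i ?z"
  obtain a b c d where i: "i = Quat a b c d" by (cases i)
  obtain p1 p2 p3 p4 where q: "q = Quat p1 p2 p3 p4" by (cases q)
  have a: "a = 0" and n: "b * b + c * c + d * d = 1"
    using quat_imaginary_unit[OF assms] by (auto simp: i power2_eq_square)
  show "q = cplx_to_quat i ?z + ?w" by (simp add: quat_ops q i)
  show "qRe ?w = 0" by (simp add: quat_ops q i a)
  \<comment> \<open>This is <q, i> |i|^2 = <q, i>, that is, the orthogonality of the remainder to
    \<open>i\<close>.\<close>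
  have "(p2 * b + p3 * c + p4 * d) * (b * b + c * c + d * d) = p2 * b + p3 * c + p4 * d"
    by (simp add: n)
  then show "?w * i = - (i * ?w)"
    by (simp add: quat_ops q i a algebra_simps)
qed

text \<open>The growth criterion speaks of closed discs, whereas the Lindelof property needs open
  sets. It is applied to the open balls whose closed versions stay inside \<open>S\<close>, and the
  selected balls are then replaced by closed ones.\<close>

lemma open_eq_countable_Union_cballs:
  fixes S :: "'a::{metric_space, second_countable_topology} set"
  assumes "open S"
  obtains F where "countable F" "\<And>B. B \<in> F \<Longrightarrow> \<exists>c r. B = cball c r" "S = \<Union>F"
proof -
  let ?U = "{B. \<exists>c e. B = ball c e \<and> cball c e \<subseteq> S}"
  obtain V where V: "V \<subseteq> ?U" "countable V" "\<Union>V = \<Union>?U"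
    by (rule Lindelof[of ?U]) auto
  have "\<forall>B\<in>V. \<exists>c e. B \<subseteq> cball c e \<and> cball c e \<subseteq> S"
    using V(1) ball_subset_cball by blast
  then obtain c e where ce: "\<And>B. B \<in> V \<Longrightarrow> B \<subseteq> cball (c B) (e B) \<and> cball (c B) (e B) \<subseteq> S"
    by metis
  have "S \<subseteq> \<Union>?U"
  proof
    fix x assume "x \<in> S"
    then obtain r where "r > 0" "cball x r \<subseteq> S" using assms open_contains_cball by blast
    then have "ball x r \<in> ?U" "x \<in> ball x r" by auto
    then show "x \<in> \<Union>?U" by blast
  qed
  show thesis
  proof (rule that[of "(\<lambda>B. cball (c B) (e B)) ` V"])
    show "countable ((\<lambda>B. cball (c B) (e B)) ` V)" using V(2) by simp
    show "\<exists>c r. B = cball c r" if "B \<in> (\<lambda>B. cball (c B) (e B)) ` V" for B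
      using that by fast
    show "S = \<Union>((\<lambda>B. cball (c B) (e B)) ` V)"
    proof (intro equalityI subsetI)
      fix x assume "x \<in> S"
      then have "x \<in> \<Union>V" using \<open>S \<subseteq> \<Union>?U\<close> by (subst V(3)) (rule subsetD)
      then obtain B where B: "B \<in> V" "x \<in> B" by (rule UnionE)
      then have "x \<in> cball (c B) (e B)" using ce[OF B(1)] by (meson subsetD)
      with B(1) show "x \<in> \<Union>((\<lambda>B. cball (c B) (e B)) ` V)" by (rule UN_I)
    next
      fix x assume "x \<in> \<Union>((\<lambda>B. cball (c B) (e B)) ` V)"
      then obtain B where B: "B \<in> V" "x \<in> cball (c B) (e B)" by (rule UN_E)
      then show "x \<in> S" using ce[OF B(1)] by (meson subsetD)
    qed
  qed
qed

lemma vimage_cnj_borel: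
  assumes "A \<in> sets borel"
  shows "cnj -` A \<in> sets borel"
proof -
  have "cnj \<in> borel_measurable borel"
    by (intro borel_measurable_continuous_onI continuous_intros)
  then show ?thesis using measurable_sets[OF _ assms, of cnj borel] by simp
qed

lemma vimage_cnj_cball: "cnj -` cball c r = cball (cnj c) r"
proof -
  have "dist c (cnj z) = dist (cnj c) z" for z
    using complex_mod_cnj[of "cnj c - z"] by (simp add: dist_norm)
  then show ?thesis by auto
qed

section \<open>The real inner product and its norm\<close>

context quat_hilbert
begin

text \<open>The real form is preferred to \<open>cinner\<close> because right multiplication by a
  general quaternion is real linear but not linear over C_i. By \<open>cinner_ip\<close> nothing is
  lost: the imaginary part of \<open>cinner\<close> is again a value of \<open>ip\<close>.\<close>

definition ip :: "'h \<Rightarrow> 'h \<Rightarrow> real" where "ip x y = qRe (qinner x y)"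

abbreviation sqn :: "'h \<Rightarrow> real" where "sqn x \<equiv> ip x x"

lemma rmult_zero_left [simp]: "rmult 0 q = 0"
  using rmult_add_left[of 0 0 q] by simp

lemma rmult_minus_left: "rmult (- x) q = - rmult x q"
  using rmult_add_left[of x "- x" q] by (simp add: eq_neg_iff_add_eq_0 add.commute)

lemma rmult_diff_left: "rmult (x - y) q = rmult x q - rmult y q"
  using rmult_add_left[of x "- y" q] by (simp add: rmult_minus_left)

lemma rmult_zero_right [simp]: "rmult x 0 = 0"
  using rmult_add_right[of x 0 0] by (simp add: quat_ops)

lemma rmult_minus_right: "rmult x (- q) = - rmult x q"
proof -
  have "rmult x (- q) + rmult x q = rmult x (- q + q)" by (simp only: rmult_add_right)
  also have "- q + q = 0" by (simp add: quat_ops)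
  finally show ?thesis by (simp add: eq_neg_iff_add_eq_0)
qed

lemma rmult_diff_right: "rmult x (p - q) = rmult x p - rmult x q"
proof -
  have "p - q = p + - q" by (simp add: quat_ops)
  then show ?thesis by (simp only: rmult_add_right rmult_minus_right) simp
qed

lemma rmult_sum: "rmult (\<Sum>k\<in>A. f k) q = (\<Sum>k\<in>A. rmult (f k) q)"
  by (induction A rule: infinite_finite_induct) (auto simp: rmult_add_left)

lemma ip_commute: "ip x y = ip y x"
  unfolding ip_def by (subst qinner_herm) (simp add: quat_ops)

lemma ip_add_right: "ip x (y + z) = ip x y + ip x z"
  by (simp add: ip_def qinner_add_right quat_ops)

lemma ip_add_left: "ip (x + y) z = ip x z + ip y z"
  by (metis ip_add_right ip_commute)

lemma ip_zero_right [simp]: "ip x 0 = 0"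
  using ip_add_right[of x 0 0] by simp

lemma ip_zero_left [simp]: "ip 0 x = 0"
  using ip_commute[of 0 x] by simp

lemma ip_minus_right: "ip x (- y) = - ip x y"
  using ip_add_right[of x y "- y"] by simp

lemma ip_minus_left: "ip (- x) y = - ip x y"
  by (metis ip_minus_right ip_commute)

lemma ip_diff_right: "ip x (y - z) = ip x y - ip x z"
  using ip_add_right[of x y "- z"] by (simp add: ip_minus_right)

lemma ip_diff_left: "ip (x - y) z = ip x z - ip y z"
  by (metis ip_diff_right ip_commute)

lemma ip_sum_right: "ip x (\<Sum>k\<in>A. f k) = (\<Sum>k\<in>A. ip x (f k))"
  by (induction A rule: infinite_finite_induct) (auto simp: ip_add_right)

lemmas ip_linear = ip_add_left ip_add_right ip_diff_left ip_diff_right ip_minus_left ip_minus_right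

lemma sqn_nonneg [simp]: "0 \<le> sqn x"
  using qinner_pos[of x] by (simp add: ip_def)

lemma sqn_eq_0 [simp]: "sqn x = 0 \<longleftrightarrow> x = 0"
proof
  assume "sqn x = 0"
  then have "qinner x x = qreal 0" using qinner_pos[of x] by (simp add: ip_def)
  then show "x = 0" using qinner_def by (simp add: quat_ops)
qed simp

lemma qnorm_sqn: "qnorm x = sqrt (sqn x)"
  by (simp add: qnorm_def ip_def)

lemma ip_rmult_left: "ip (rmult x q) y = ip x (rmult y (qcnj q))"
proof -
  have "ip (rmult x q) y = qRe (qcnj (qinner y x * q))"
    unfolding ip_def by (subst qinner_herm) (simp add: qinner_rmult_right)
  also have "qinner y x = qcnj (qinner x y)" by (rule qinner_herm)
  also have "qRe (qcnj (qcnj (qinner x y) * q)) = qRe (qinner x y * qcnj q)"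
    by (simp add: quat_ops)
  finally show ?thesis by (simp add: ip_def qinner_rmult_right)
qed

lemma ip_rmult_qreal: "ip x (rmult y (qreal a)) = a * ip x y"
  by (simp add: ip_def qinner_rmult_right) (simp add: quat_ops)

lemma ip_rmult_rmult:
  "ip (rmult x q) (rmult y q) = ((qRe q)\<^sup>2 + (qI q)\<^sup>2 + (qJ q)\<^sup>2 + (qK q)\<^sup>2) * ip x y"
proof -
  have "q * qcnj q = qreal ((qRe q)\<^sup>2 + (qI q)\<^sup>2 + (qJ q)\<^sup>2 + (qK q)\<^sup>2)"
    by (simp add: quat_ops power2_eq_square)
  then show ?thesis
    by (simp add: ip_rmult_left rmult_assoc[symmetric] ip_rmult_qreal)
qed

lemma Cauchy_Schwarz_ip: "\<bar>ip x y\<bar> \<le> qnorm x * qnorm y"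
proof -
  have "(ip x y)\<^sup>2 \<le> sqn x * sqn y"
  proof (cases "y = 0")
    case False
    then have pos: "sqn y > 0" using sqn_nonneg[of y] sqn_eq_0[of y] by linarith
    define t where "t = ip x y / sqn y"
    define v where "v = x - rmult y (qreal t)"
    have "0 \<le> sqn v" by simp
    also have "sqn v = sqn x - 2 * t * ip x y + t * t * sqn y"
      unfolding v_def
      by (simp add: ip_linear ip_rmult_qreal ip_commute[of "rmult y (qreal t)"] algebra_simps)
    also have "\<dots> = sqn x - (ip x y)\<^sup>2 / sqn y"
      using pos by (simp add: t_def field_simps power2_eq_square)
    finally show ?thesis using pos by (simp add: field_simps)
  qed simp
  then have "sqrt ((ip x y)\<^sup>2) \<le> sqrt (sqn x * sqn y)" by (rule real_sqrt_le_mono)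
  then show ?thesis by (simp add: qnorm_sqn real_sqrt_mult)
qed

lemma qnorm_nonneg [simp]: "0 \<le> qnorm x"
  by (simp add: qnorm_sqn)

lemma qnorm_power2: "(qnorm x)\<^sup>2 = sqn x"
  by (simp add: qnorm_sqn)

lemma qnorm_triangle: "qnorm (x + y) \<le> qnorm x + qnorm y"
proof (rule power2_le_imp_le)
  have "(qnorm (x + y))\<^sup>2 = sqn x + 2 * ip x y + sqn y"
    by (simp add: qnorm_power2 ip_linear ip_commute[of y x])
  also have "\<dots> \<le> sqn x + 2 * (qnorm x * qnorm y) + sqn y"
    using Cauchy_Schwarz_ip[of x y] by linarith
  also have "\<dots> = (qnorm x + qnorm y)\<^sup>2"
    by (simp add: power2_sum qnorm_power2)
  finally show "(qnorm (x + y))\<^sup>2 \<le> (qnorm x + qnorm y)\<^sup>2" .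
qed simp

lemma qnorm_minus: "qnorm (- x) = qnorm x"
  by (simp add: qnorm_sqn ip_linear)

text \<open>The type \<open>'h\<close> carries no topology, so convergence is always stated through
  \<open>qnorm\<close> and uniqueness of limits has to be supplied in that form.\<close>

lemma qnorm_limit_unique:
  assumes "(\<lambda>n. qnorm (a n - x)) \<longlonglongrightarrow> 0" "(\<lambda>n. qnorm (a n - y)) \<longlonglongrightarrow> 0"
  shows "x = y"
proof -
  have "qnorm (x - y) \<le> qnorm (a n - x) + qnorm (a n - y)" for n
    using qnorm_triangle[of "- (a n - x)" "a n - y"] qnorm_minus[of "a n - x"] by simp
  moreover have "(\<lambda>n. qnorm (a n - x) + qnorm (a n - y)) \<longlonglongrightarrow> 0"
    using tendsto_add[OF assms] by simp
  ultimately have "qnorm (x - y) \<le> 0"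
    by (intro tendsto_lowerbound[of _ 0 sequentially]) auto
  then show ?thesis
    using sqn_nonneg[of "x - y"] sqn_eq_0[of "x - y"] by (simp add: qnorm_sqn)
qed

lemma right_linear_rmult:
  assumes "right_linear T"
  shows "T (rmult x q) = rmult (T x) q"
  using assms[unfolded right_linear_def, rule_format, of x q 0 0]
  by (simp add: rmult_one)

lemma right_linear_add:
  assumes "right_linear T"
  shows "T (x + y) = T x + T y"
  using assms[unfolded right_linear_def, rule_format, of x 1 y 1] by (simp add: rmult_one)

lemma right_linearI:
  assumes "\<And>x y. T (x + y) = T x + T y" "\<And>x q. T (rmult x q) = rmult (T x) q"
  shows "right_linear T"
  by (simp add: right_linear_def assms)

lemma cmult_add_left: "cmult i (x + y) c = cmult i x c + cmult i y c"
  by (simp add: cmult_def rmult_add_left)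

lemma cmult_diff_right: "cmult i x (c - d) = cmult i x c - cmult i x d"
proof -
  have "cplx_to_quat i (c - d) = cplx_to_quat i c - cplx_to_quat i d"
    by (simp add: quat_ops algebra_simps)
  then show ?thesis by (simp add: cmult_def rmult_diff_right)
qed

lemma cmult_0_right [simp]: "cmult i x 0 = 0"
  using cmult_diff_right[of i x 0 0] by simp

lemma cmult_1_right [simp]: "cmult i x 1 = x"
proof -
  have "cplx_to_quat i 1 = 1" by (simp add: quat_ops)
  then show ?thesis by (simp add: cmult_def rmult_one)
qed

lemma cinner_ip: "cinner i x y = Complex (ip x y) (- ip x (rmult y i))"
  by (simp add: cinner_def ip_def qinner_rmult_right)

lemma ip_cmult_right: "ip x (cmult i y c) = Re c * ip x y + Im c * ip x (rmult y i)"
  unfolding cmult_def cplx_to_quat_def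
  by (simp add: rmult_add_right ip_add_right ip_rmult_qreal) 
     (simp add: ip_def qinner_rmult_right, simp add: quat_ops algebra_simps)

end


section \<open>The operator together with its spectral data\<close>

locale quat_spectral = quat_hilbert rmult qinner
  for rmult :: "'h::ab_group_add \<Rightarrow> quat \<Rightarrow> 'h" and qinner :: "'h \<Rightarrow> 'h \<Rightarrow> quat" +
  fixes i :: quat and T :: "'h \<Rightarrow> 'h" and E :: "complex set \<Rightarrow> 'h \<Rightarrow> 'h"
  assumes i_qS: "i \<in> qS"
    and T_right_linear: "right_linear T"
    and spectral_measure: "spectral_measure_of i T E"
begin

abbreviation \<sigma> :: "complex set" where "\<sigma> \<equiv> spectrum_i i T"

text \<open>Extending E to all Borel sets of the plane makes complements and conjugates available
  without knowing that the spectrum is Borel or symmetric.\<close>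

definition P :: "complex set \<Rightarrow> 'h \<Rightarrow> 'h" where "P A = E (\<sigma> \<inter> A)"

text \<open>This is T - c on H_i. The scalar acts from the right, so for non-real \<open>c\<close>
  the operator commutes with right multiplication by C_i but in general not with that by other
  quaternions.\<close>

definition D :: "complex \<Rightarrow> 'h \<Rightarrow> 'h" where "D c x = T x - cmult i x c"

lemma sets_\<sigma>: "A \<in> sets borel \<Longrightarrow> \<sigma> \<inter> A \<in> sets (restrict_space borel \<sigma>)"
  by (auto simp: sets_restrict_space)

lemma rmult_i_i: "rmult (rmult x i) i = - x"
  using i_qS by (simp add: rmult_assoc[symmetric] qS_def rmult_minus_right rmult_one)

lemma ip_rmult_i: "ip (rmult x i) (rmult y i) = ip x y"
  using quat_imaginary_unit[OF i_qS] by (simp add: ip_rmult_rmult)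

lemma ip_rmult_i_left: "ip (rmult x i) y = - ip x (rmult y i)"
  using ip_rmult_i[of x "rmult y i"] by (simp add: rmult_i_i ip_linear)

lemma cmult_imaginary_unit: "cmult i x \<i> = rmult x i"
proof -
  have "cplx_to_quat i \<i> = i" by (simp add: quat_ops)
  then show ?thesis by (simp add: cmult_def)
qed

lemma sqn_cmult: "sqn (cmult i x c) = (cmod c)\<^sup>2 * sqn x"
proof -
  have "(qRe (cplx_to_quat i c))\<^sup>2 + (qI (cplx_to_quat i c))\<^sup>2 + (qJ (cplx_to_quat i c))\<^sup>2
      + (qK (cplx_to_quat i c))\<^sup>2
      = (Re c)\<^sup>2 + (Im c)\<^sup>2 * ((qI i)\<^sup>2 + (qJ i)\<^sup>2 + (qK i)\<^sup>2)"
    using quat_imaginary_unit(1)[OF i_qS]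
    by (simp add: quat_ops power_mult_distrib algebra_simps)
  also have "\<dots> = (cmod c)\<^sup>2"
    using quat_imaginary_unit(2)[OF i_qS] by (simp add: cmod_power2)
  finally show ?thesis by (simp add: cmult_def ip_rmult_rmult)
qed

lemma T_rmult: "T (rmult x q) = rmult (T x) q"
  by (rule right_linear_rmult[OF T_right_linear])

lemma T_add: "T (x + y) = T x + T y"
  by (rule right_linear_add[OF T_right_linear])

lemma D_add: "D c (x + y) = D c x + D c y"
  by (simp add: D_def T_add cmult_add_left)

lemma D_zero [simp]: "D c 0 = 0"
  using D_add[of c 0 0] by simp

lemma D_minus: "D c (- x) = - D c x"
  using D_add[of c x "- x"] by (simp add: eq_neg_iff_add_eq_0 add.commute)

lemma D_diff: "D c (x - y) = D c x - D c y"
  using D_add[of c x "- y"] by (simp add: D_minus)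

lemma D_rmult_i: "D c (rmult x i) = rmult (D c x) i"
proof -
  have "i * cplx_to_quat i c = cplx_to_quat i c * i" by (simp add: quat_ops algebra_simps)
  then show ?thesis
    by (simp add: D_def T_rmult rmult_diff_left cmult_def rmult_assoc[symmetric])
qed

lemma D_shift: "D c x = D d x + cmult i x (d - c)"
  by (simp add: D_def cmult_diff_right)

section \<open>The projections as a spectral measure on the plane\<close>

lemma P_orth_proj: "A \<in> sets borel \<Longrightarrow> orth_proj_i i (P A)"
  using spectral_measure sets_\<sigma> by (auto simp: spectral_measure_of_def P_def Let_def)

lemma P_empty [simp]: "P {} x = 0"
  using spectral_measure by (auto simp: spectral_measure_of_def P_def Let_def)

lemma P_UNIV [simp]: "P UNIV x = x"
  using spectral_measure by (auto simp: spectral_measure_of_def P_def Let_def)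

lemma P_Int:
  assumes "A \<in> sets borel" "B \<in> sets borel"
  shows "P (A \<inter> B) x = P A (P B x)"
proof -
  have "E ((\<sigma> \<inter> A) \<inter> (\<sigma> \<inter> B)) = E (\<sigma> \<inter> A) \<circ> E (\<sigma> \<inter> B)"
    using spectral_measure sets_\<sigma>[OF assms(1)] sets_\<sigma>[OF assms(2)]
    by (simp add: spectral_measure_of_def Let_def)
  moreover have "(\<sigma> \<inter> A) \<inter> (\<sigma> \<inter> B) = \<sigma> \<inter> (A \<inter> B)" by blast
  ultimately show ?thesis by (simp add: P_def)
qed

lemma P_idem: "A \<in> sets borel \<Longrightarrow> P A (P A x) = P A x"
  using P_Int[of A A] by simp

text \<open>Keeps track of the support when a vector is cut along \<open>B\<close>; the induction
  over a finite cover by discs relies on it.\<close>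

lemma P_Int_P:
  assumes "A \<in> sets borel" "B \<in> sets borel" "P A x = x"
  shows "P (A \<inter> B) (P B x) = P B x"
proof -
  have "P (A \<inter> B) (P B x) = P (A \<inter> B) x"
    using assms by (simp only: P_Int P_idem)
  also have "\<dots> = P (B \<inter> A) x" by (simp only: Int_commute)
  also have "\<dots> = P B x" using assms by (simp add: P_Int)
  finally show ?thesis .
qed

lemma P_cmult_add:
  "A \<in> sets borel \<Longrightarrow> P A (cmult i x a + cmult i y b) = cmult i (P A x) a + cmult i (P A y) b"
  using P_orth_proj[of A] by (simp add: orth_proj_i_def clinear_def)

lemma P_cmult: "A \<in> sets borel \<Longrightarrow> P A (cmult i x c) = cmult i (P A x) c"
  using P_cmult_add[of A x c 0 0] by simp

lemma P_add: "A \<in> sets borel \<Longrightarrow> P A (x + y) = P A x + P A y"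
  using P_cmult_add[of A x 1 y 1] by simp

lemma P_zero [simp]: "A \<in> sets borel \<Longrightarrow> P A 0 = 0"
  using P_add[of A 0 0] by simp

lemma P_minus: "A \<in> sets borel \<Longrightarrow> P A (- x) = - P A x"
  using P_add[of A x "- x"] by (simp add: eq_neg_iff_add_eq_0 add.commute)

lemma P_diff: "A \<in> sets borel \<Longrightarrow> P A (x - y) = P A x - P A y"
  using P_add[of A x "- y"] by (simp add: P_minus)

lemma P_rmult_i: "A \<in> sets borel \<Longrightarrow> P A (rmult x i) = rmult (P A x) i"
  using P_cmult[of A x \<i>] by (simp add: cmult_imaginary_unit)

lemma P_ip:
  assumes "A \<in> sets borel"
  shows "ip (P A x) y = ip x (P A y)"
proof -
  have "cinner i (P A x) y = cinner i x (P A y)"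
    using P_orth_proj[OF assms] by (simp add: orth_proj_i_def)
  then show ?thesis by (simp add: cinner_ip)
qed

lemma ip_P_eq_sqn: "A \<in> sets borel \<Longrightarrow> ip x (P A x) = sqn (P A x)"
  by (simp add: P_ip P_idem)

lemma E_countably_additive:
  assumes "\<And>n. A n \<in> sets (restrict_space borel \<sigma>)" "disjoint_family A"
  shows "(\<lambda>n. qnorm ((\<Sum>k<n. E (A k) x) - E (\<Union>k. A k) x)) \<longlonglongrightarrow> 0"
  using spectral_measure assms unfolding spectral_measure_of_def Let_def by blast

lemma P_countably_additive:
  assumes "\<And>n. A n \<in> sets borel" "disjoint_family A"
  shows "(\<lambda>n. qnorm ((\<Sum>k<n. P (A k) x) - P (\<Union>k. A k) x)) \<longlonglongrightarrow> 0"
proof -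
  have "\<forall>n. \<sigma> \<inter> A n \<in> sets (restrict_space borel \<sigma>)" using assms sets_\<sigma> by blast
  moreover have "disjoint_family (\<lambda>n. \<sigma> \<inter> A n)"
    using assms(2) by (auto simp: disjoint_family_on_def)
  ultimately have "(\<lambda>n. qnorm ((\<Sum>k<n. E (\<sigma> \<inter> A k) x) - E (\<Union>k. \<sigma> \<inter> A k) x)) \<longlonglongrightarrow> 0"
    by (intro E_countably_additive) auto
  moreover have "(\<Union>k. \<sigma> \<inter> A k) = \<sigma> \<inter> (\<Union>k. A k)" by blast
  ultimately show ?thesis by (simp add: P_def)
qed

text \<open>Only countable additivity is given. Padding the two sets with empty ones through
  \<open>binaryset\<close> makes the partial sums constant from index 2 on.\<close>

lemma P_compl:
  assumes "A \<in> sets borel"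
  shows "P (- A) x = x - P A x"
proof -
  let ?B = "binaryset A (- A)"
  have "(\<lambda>n. qnorm ((\<Sum>k<n. P (?B k) x) - P (\<Union>k. ?B k) x)) \<longlonglongrightarrow> 0"
    using assms by (intro P_countably_additive)
      (auto simp: binaryset_def disjoint_family_on_def)
  moreover have "(\<Union>k. ?B k) = UNIV" using UN_binaryset_eq[of A "- A"] by simp
  ultimately have lim: "(\<lambda>n. qnorm ((\<Sum>k<n. P (?B k) x) - x)) \<longlonglongrightarrow> 0" by simp
  have "(\<Sum>k<n. P (?B k) x) = P A x + P (- A) x" if "n \<ge> 2" for n
  proof -
    have "(\<Sum>k<n. P (?B k) x) = (\<Sum>k<2. P (?B k) x)"
      using that by (intro sum.mono_neutral_right) (auto simp: binaryset_def)
    also have "\<dots> = P A x + P (- A) x" by (simp add: numeral_2_eq_2 binaryset_def)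
    finally show ?thesis .
  qed
  then have "\<forall>\<^sub>F n in sequentially. qnorm ((\<Sum>k<n. P (?B k) x) - (P A x + P (- A) x)) = 0"
    by (auto simp: eventually_sequentially qnorm_sqn intro!: exI[of _ 2])
  then have "(\<lambda>n. qnorm ((\<Sum>k<n. P (?B k) x) - (P A x + P (- A) x))) \<longlonglongrightarrow> 0"
    by (rule tendsto_eventually)
  then have "P A x + P (- A) x = x" using lim by (rule qnorm_limit_unique)
  then show ?thesis by (simp add: algebra_simps)
qed

lemma sqn_split:
  assumes "A \<in> sets borel"
  shows "sqn x = sqn (P A x) + sqn (P (- A) x)"
  using assms by (simp add: P_compl ip_linear ip_P_eq_sqn ip_commute[of "P A x" x])

section \<open>The scalar measures and the weak integral\<close>

abbreviation \<mu> :: "'h \<Rightarrow> complex measure" where "\<mu> x \<equiv> spec_scalar_measure i \<sigma> E x"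

lemma space_\<mu> [simp]: "space (\<mu> x) = \<sigma>"
  unfolding spec_scalar_measure_def
  by (rule space_measure_of) (auto simp: sets_restrict_space)

lemma sets_\<mu> [simp]: "sets (\<mu> x) = sets (restrict_space borel \<sigma>)"
  unfolding spec_scalar_measure_def
  using sets.sigma_sets_eq[of "restrict_space borel \<sigma>"]
  by (subst sets_measure_of) (auto simp: sets_restrict_space space_restrict_space)

text \<open>\<open>measure_of\<close> returns the given set function only if that function is a
  measure, and zero otherwise, so countable additivity must be checked. It passes from norm
  convergence to \<open>ip x\<close> by Cauchy-Schwarz.\<close>

lemma emeasure_\<mu>:
  assumes "A \<in> sets borel"
  shows "emeasure (\<mu> x) (\<sigma> \<inter> A) = ennreal (sqn (P A x))"
proof -
  let ?f = "\<lambda>B. ennreal (Re (cinner i x (E B x)))"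
  have f: "?f (\<sigma> \<inter> B) = ennreal (sqn (P B x))" if "B \<in> sets borel" for B
    using ip_P_eq_sqn[OF that, of x] by (simp add: cinner_ip P_def)
  have "emeasure (\<mu> x) (\<sigma> \<inter> A) = ?f (\<sigma> \<inter> A)"
  proof (rule emeasure_measure_of[OF spec_scalar_measure_def])
    show "sets (restrict_space borel \<sigma>) \<subseteq> Pow \<sigma>" by (auto simp: sets_restrict_space)
    show "\<sigma> \<inter> A \<in> sets (\<mu> x)" using sets_\<sigma>[OF assms] by simp
    show "positive (sets (\<mu> x)) ?f"
      using f[of "{}"] by (simp add: positive_def)
    show "countably_additive (sets (\<mu> x)) ?f"
    proof (rule countably_additiveI)
      fix B :: "nat \<Rightarrow> complex set"
      assume B: "range B \<subseteq> sets (\<mu> x)" "disjoint_family B"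
      then have lim: "(\<lambda>n. qnorm ((\<Sum>k<n. E (B k) x) - E (\<Union>k. B k) x)) \<longlonglongrightarrow> 0"
        by (intro E_countably_additive) auto
      have nonneg: "0 \<le> ip x (E (B n) x)" for n
      proof -
        obtain C where "C \<in> sets borel" "B n = \<sigma> \<inter> C"
          using B(1) by (auto simp: sets_restrict_space)
        then show ?thesis using ip_P_eq_sqn[of C x] by (simp add: P_def)
      qed
      have "(\<lambda>n. (\<Sum>k<n. ip x (E (B k) x)) - ip x (E (\<Union>k. B k) x)) \<longlonglongrightarrow> 0"
      proof (rule Lim_null_comparison)
        show "\<forall>\<^sub>F n in sequentially. norm ((\<Sum>k<n. ip x (E (B k) x)) - ip x (E (\<Union>k. B k) x))
              \<le> qnorm x * qnorm ((\<Sum>k<n. E (B k) x) - E (\<Union>k. B k) x)"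
          using Cauchy_Schwarz_ip by (simp add: ip_sum_right[symmetric] ip_diff_right[symmetric])
        show "(\<lambda>n. qnorm x * qnorm ((\<Sum>k<n. E (B k) x) - E (\<Union>k. B k) x)) \<longlonglongrightarrow> 0"
          using tendsto_mult_right_zero[OF lim] .
      qed
      then have "(\<lambda>k. ip x (E (B k) x)) sums ip x (E (\<Union>k. B k) x)"
        unfolding sums_def by (rule LIM_zero_cancel)
      then show "(\<Sum>n. ?f (B n)) = ?f (\<Union>n. B n)"
        using nonneg by (simp add: cinner_ip) (rule suminf_ennreal_eq)
    qed
  qed
  then show ?thesis using f[OF assms] by simp
qed

text \<open>Both sides give a set B the mass |P (B \<inter> A) x|^2. Integrals over \<open>A\<close>
  thereby become quadratic forms at \<open>P A x\<close>.\<close>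

lemma \<mu>_P:
  assumes "A \<in> sets borel"
  shows "\<mu> (P A x) = density (\<mu> x) (indicator A)"
proof (rule measure_eqI)
  fix C assume "C \<in> sets (\<mu> (P A x))"
  then obtain B where B: "B \<in> sets borel" "C = \<sigma> \<inter> B" by (auto simp: sets_restrict_space)
  have "emeasure (density (\<mu> x) (indicator A)) C
      = (\<integral>\<^sup>+z. indicator (\<sigma> \<inter> A) z * indicator C z \<partial>\<mu> x)"
  proof -
    have "(indicator A :: complex \<Rightarrow> ennreal) \<in> borel_measurable (\<mu> x)"
      using assms by (intro borel_measurable_indicator') (auto simp: sets_restrict_space)
    moreover have "C \<in> sets (\<mu> x)" using B sets_\<sigma> by simp
    ultimately show ?thesis
      by (subst emeasure_density) (auto intro!: nn_integral_cong simp: indicator_def)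
  qed
  also have "\<dots> = (\<integral>\<^sup>+z. indicator (\<sigma> \<inter> (B \<inter> A)) z \<partial>\<mu> x)"
    by (intro nn_integral_cong) (auto simp: indicator_def B)
  also have "\<dots> = emeasure (\<mu> x) (\<sigma> \<inter> (B \<inter> A))"
    using sets_\<sigma>[of "B \<inter> A"] assms B by (intro nn_integral_indicator) simp
  also have "\<dots> = emeasure (\<mu> (P A x)) C"
    using assms B by (simp add: emeasure_\<mu> P_Int)
  finally show "emeasure (\<mu> (P A x)) C = emeasure (density (\<mu> x) (indicator A)) C" by simp
qed simp

lemma integrable_\<mu>: "integrable (\<mu> x) (\<lambda>z. z)"
  and cinner_T: "cinner i x (T x) = (LINT z|\<mu> x. z)"
  using spectral_measure by (auto simp: spectral_measure_of_def Let_def)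

lemma measurable_id_\<mu>: "(\<lambda>z. z) \<in> borel_measurable (\<mu> x)"
  using integrable_\<mu> by (rule borel_measurable_integrable)

lemma indicator_measurable_\<mu>:
  "A \<in> sets borel \<Longrightarrow> (indicator A :: complex \<Rightarrow> real) \<in> borel_measurable (\<mu> x)"
  by (intro borel_measurable_indicator') (auto simp: sets_restrict_space)

lemma cinner_T_P:
  assumes "A \<in> sets borel"
  shows "cinner i (P A x) (T (P A x)) = (LINT z|\<mu> x. indicator A z *\<^sub>R z)"
proof -
  have "cinner i (P A x) (T (P A x))
      = (LINT z|density (\<mu> x) (\<lambda>z. ennreal (indicator A z)). z)"
    unfolding cinner_T by (simp add: \<mu>_P[OF assms] ennreal_indicator)
  also have "\<dots> = (LINT z|\<mu> x. indicator A z *\<^sub>R z)"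
    using measurable_id_\<mu> indicator_measurable_\<mu>[OF assms] by (intro integral_density) auto
  finally show ?thesis .
qed

text \<open>The integral splits over \<open>A\<close> and its complement, so the quadratic form of
  \<open>T\<close> has no cross terms between the two ranges. This is the source of the commutation
  of \<open>T\<close> with the projections.\<close>

lemma cinner_T_split:
  assumes "A \<in> sets borel"
  shows "cinner i x (T x)
    = cinner i (P A x) (T (P A x)) + cinner i (P (- A) x) (T (P (- A) x))"
proof -
  have int: "integrable (\<mu> x) (\<lambda>z. indicator B z *\<^sub>R z)" if "B \<in> sets borel" for B
  proof (rule Bochner_Integration.integrable_bound[OF integrable_\<mu>])
    show "(\<lambda>z. indicator B z *\<^sub>R z) \<in> borel_measurable (\<mu> x)"
      by (intro borel_measurable_scaleR indicator_measurable_\<mu> that measurable_id_\<mu>)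
    show "AE z in \<mu> x. norm (indicator B z *\<^sub>R z) \<le> norm z"
      by (intro AE_I2) (simp add: indicator_def)
  qed
  have "(LINT z|\<mu> x. z) = (LINT z|\<mu> x. indicator A z *\<^sub>R z + indicator (- A) z *\<^sub>R z)"
    by (rule Bochner_Integration.integral_cong) (auto simp: indicator_def)
  also have "\<dots> = (LINT z|\<mu> x. indicator A z *\<^sub>R z) + (LINT z|\<mu> x. indicator (- A) z *\<^sub>R z)"
    using assms by (intro Bochner_Integration.integral_add int) auto
  finally show ?thesis
    unfolding cinner_T_P[OF assms] cinner_T_P[OF borel_comp[OF assms]] by (simp only: cinner_T)
qed

text \<open>The measure of \<open>x\<close> has total mass |x|^2 and is concentrated on
  \<open>A\<close>, so the difference to be bounded is the integral of z - d against it.\<close>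

lemma cinner_T_near:
  assumes A: "A \<in> sets borel" and x: "P A x = x" and near: "\<And>z. z \<in> A \<Longrightarrow> cmod (z - d) \<le> e"
    and "e \<ge> 0"
  shows "cmod (cinner i x (T x) - d * sqn x) \<le> e * sqn x"
proof -
  have fin: "emeasure (\<mu> x) \<sigma> = ennreal (sqn x)" using emeasure_\<mu>[of UNIV x] by simp
  then interpret finite_measure "\<mu> x" by (intro finite_measureI) simp
  have m: "measure (\<mu> x) \<sigma> = sqn x" using fin by (simp add: measure_def)
  have "P (- A) x = 0" using P_compl[OF A, of x] x by simp
  then have "emeasure (\<mu> x) (\<sigma> \<inter> - A) = 0" using A by (simp add: emeasure_\<mu>)
  then have AE: "AE z in \<mu> x. cmod (z - d) \<le> e"
    using near sets_\<sigma>[of "- A"] A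
    by (intro AE_I[of _ _ "\<sigma> \<inter> - A"]) auto
  have "cinner i x (T x) - d * sqn x = (LINT z|\<mu> x. z - d)"
    using integrable_\<mu>[of x] m by (simp add: cinner_T scaleR_conv_of_real)
  also have "cmod \<dots> \<le> (LINT z|\<mu> x. cmod (z - d))" by (rule integral_norm_bound)
  also have "\<dots> \<le> (LINT z|\<mu> x. e)"
    using integrable_\<mu>[of x] AE by (intro integral_mono_AE) auto
  also have "\<dots> = e * sqn x" using m by simp
  finally show ?thesis .
qed

section \<open>Commutation of \<open>T\<close> with the projections\<close>

lemma T_cross_sum:
  assumes A: "A \<in> sets borel" and u: "P A u = u" and v: "P (- A) v = v"
  shows "ip u (T v) + ip v (T u) = 0"
    and "ip u (rmult (T v) i) + ip v (rmult (T u) i) = 0"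
proof -
  have "P A v = 0" "P (- A) u = 0"
    using P_compl[OF A, of v] P_compl[OF A, of u] u v by auto
  then have "P A (u + v) = u" "P (- A) (u + v) = v"
    using A u v by (auto simp: P_add)
  then have "cinner i (u + v) (T (u + v)) = cinner i u (T u) + cinner i v (T v)"
    using cinner_T_split[OF A, of "u + v"] by simp
  then show "ip u (T v) + ip v (T u) = 0"
    and "ip u (rmult (T v) i) + ip v (rmult (T u) i) = 0"
    by (auto simp: cinner_ip complex_eq_iff T_add ip_linear rmult_add_left)
qed

text \<open>The missing cross terms only give the vanishing of a symmetrized sum. Replacing
  \<open>v\<close> by its right multiple by \<open>i\<close> reverses the relative sign of the two
  summands, so each of them vanishes.\<close>

lemma T_cross:
  assumes A: "A \<in> sets borel" and u: "P A u = u" and v: "P (- A) v = v"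
  shows "ip u (T v) = 0"
proof -
  have "P (- A) (rmult v i) = rmult v i" using A v by (simp add: P_rmult_i)
  from T_cross_sum(2)[OF A u this] have "- ip u (T v) + ip v (T u) = 0"
    by (simp add: T_rmult rmult_i_i ip_linear ip_rmult_i)
  with T_cross_sum(1)[OF A u v] show ?thesis by linarith
qed

lemma P_T_P_compl:
  assumes A: "A \<in> sets borel"
  shows "P A (T (P (- A) x)) = 0"
proof -
  let ?v = "P (- A) x"
  have "sqn (P A (T ?v)) = ip (P A (T ?v)) (T ?v)"
    using A by (simp add: P_ip P_idem ip_commute)
  also have "\<dots> = 0" using A by (intro T_cross[OF A]) (auto simp: P_idem)
  finally show ?thesis by simp
qed

text \<open>\<open>P_T_P_compl\<close>, used for \<open>A\<close> and for its complement, says that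
  \<open>T\<close> leaves both ranges invariant, and these two ranges span the space.\<close>

lemma P_T:
  assumes A: "A \<in> sets borel"
  shows "P A (T x) = T (P A x)"
proof -
  have "P A (T x) = P A (T (P A x + P (- A) x))" using A by (simp add: P_compl)
  also have "\<dots> = P A (T (P A x))"
    using A P_T_P_compl[OF A] by (simp only: T_add P_add) simp
  also have "\<dots> = T (P A x)"
    using P_T_P_compl[of "- A" x] P_compl[OF A, of "T (P A x)"] A by simp
  finally show ?thesis .
qed

section \<open>Norm bounds for T - c on spectral subspaces\<close>

lemma P_D: "A \<in> sets borel \<Longrightarrow> P A (D c x) = D c (P A x)"
  by (simp add: D_def P_diff P_T P_cmult)

lemma P_D_funpow: "A \<in> sets borel \<Longrightarrow> P A ((D c ^^ n) x) = (D c ^^ n) (P A x)"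
  by (induction n) (auto simp: P_D)

lemma sqn_D_split:
  "A \<in> sets borel \<Longrightarrow> sqn (D c x) = sqn (D c (P A x)) + sqn (D c (P (- A) x))"
  using sqn_split[of A "D c x"] by (simp add: P_D)

text \<open>The two numbers are, up to sign, the real and imaginary parts of the complex number
  estimated in \<open>cinner_T_near\<close>.\<close>

lemma numerical_range_D:
  assumes A: "A \<in> sets borel" and x: "P A x = x" and near: "\<And>z. z \<in> A \<Longrightarrow> cmod (z - d) \<le> e"
    and "e \<ge> 0"
  shows "\<bar>ip x (D d x)\<bar> \<le> e * sqn x" "\<bar>ip x (rmult (D d x) i)\<bar> \<le> e * sqn x"
proof -
  have 0: "ip x (rmult x i) = 0"
    using ip_rmult_i_left[of x x] ip_commute[of x "rmult x i"] by simp
  have 1: "ip x (D d x) = Re (cinner i x (T x) - d * sqn x)"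
    by (simp add: D_def cinner_ip ip_linear ip_cmult_right 0)
  have "ip x (rmult (cmult i x d) i) = - ip (rmult x i) (cmult i x d)"
    by (simp add: ip_rmult_i_left)
  also have "\<dots> = - Im d * sqn x"
    using 0 by (simp add: ip_cmult_right ip_rmult_i ip_commute)
  finally have 2: "ip x (rmult (D d x) i) = - Im (cinner i x (T x) - d * sqn x)"
    by (simp add: D_def cinner_ip rmult_diff_left ip_linear)
  show "\<bar>ip x (D d x)\<bar> \<le> e * sqn x" "\<bar>ip x (rmult (D d x) i)\<bar> \<le> e * sqn x"
    unfolding 1 2 abs_minus_cancel
    using cinner_T_near[OF assms] abs_Re_le_cmod abs_Im_le_cmod order_trans by blast+
qed

text \<open>Polarization bounds the sesquilinear form of D d by its quadratic form, at the cost of a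
  factor 2.\<close>

lemma sqn_D_near:
  assumes A: "A \<in> sets borel" and x: "P A x = x" and near: "\<And>z. z \<in> A \<Longrightarrow> cmod (z - d) \<le> e"
    and e: "e > 0"
  shows "sqn (D d x) \<le> (2 * e)\<^sup>2 * sqn x"
proof -
  have nr: "\<bar>ip u (D d u)\<bar> \<le> e * sqn u" "\<bar>ip u (rmult (D d u) i)\<bar> \<le> e * sqn u" if "P A u = u" for u
    using numerical_range_D[OF A that, of d e] near e by auto
  have half: "\<bar>t\<bar> \<le> m" if "2 * t = a - b" "\<bar>a\<bar> \<le> p" "\<bar>b\<bar> \<le> q" "p + q = 2 * m" for a b p q m t :: real
    using that by linarith
  \<comment> \<open>Polarization with u + v and u - v; the parallelogram law adds up the two
    bounds.\<close>
  have symm: "\<bar>ip v (D d u) + ip u (D d v)\<bar> \<le> e * (sqn u + sqn v)"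
    "\<bar>ip v (rmult (D d u) i) + ip u (rmult (D d v) i)\<bar> \<le> e * (sqn u + sqn v)"
    if u: "P A u = u" and v: "P A v = v" for u v
  proof -
    have p: "P A (u + v) = u + v" and m: "P A (u - v) = u - v"
      using A u v by (auto simp: P_add P_diff)
    have par: "e * sqn (u + v) + e * sqn (u - v) = 2 * (e * (sqn u + sqn v))"
      by (simp add: ip_linear algebra_simps)
    have "2 * (ip v (D d u) + ip u (D d v)) = ip (u + v) (D d (u + v)) - ip (u - v) (D d (u - v))"
      by (simp add: D_add D_diff ip_linear)
    then show "\<bar>ip v (D d u) + ip u (D d v)\<bar> \<le> e * (sqn u + sqn v)"
      by (rule half[OF _ nr(1)[OF p] nr(1)[OF m] par])
    have "2 * (ip v (rmult (D d u) i) + ip u (rmult (D d v) i))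
        = ip (u + v) (rmult (D d (u + v)) i) - ip (u - v) (rmult (D d (u - v)) i)"
      by (simp add: D_add D_diff rmult_add_left rmult_diff_left ip_linear)
    then show "\<bar>ip v (rmult (D d u) i) + ip u (rmult (D d v) i)\<bar> \<le> e * (sqn u + sqn v)"
      by (rule half[OF _ nr(2)[OF p] nr(2)[OF m] par])
  qed
  \<comment> \<open>Passing from \<open>v\<close> to its right multiple by \<open>i\<close> turns
    the sum of the two mixed terms into their difference. Adding both bounds isolates a single
    term.\<close>
  have form: "ip v (D d x) \<le> e * (sqn x + sqn v)" if v: "P A v = v" for v
  proof -
    have "P A (rmult v i) = rmult v i" using A v by (simp add: P_rmult_i)
    from symm(2)[OF x this] have "\<bar>ip v (D d x) - ip x (D d v)\<bar> \<le> e * (sqn x + sqn v)"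
      by (simp add: D_rmult_i rmult_i_i ip_rmult_i ip_linear)
    with symm(1)[OF x v] show ?thesis by linarith
  qed
  \<comment> \<open>Testing with v = t (T - d) x bounds (t - e t^2) |(T - d) x|^2 by e |x|^2. This
    choice of \<open>t\<close> maximizes the factor, with value 1 / (4 e).\<close>
  define t where "t = 1 / (2 * e)"
  define v where "v = cmult i (D d x) (complex_of_real t)"
  have "P A v = v" using A x by (simp add: v_def P_cmult P_D)
  moreover have "ip v (D d x) = t * sqn (D d x)"
    by (subst ip_commute) (simp add: v_def ip_cmult_right)
  moreover have "sqn v = t\<^sup>2 * sqn (D d x)" by (simp add: v_def sqn_cmult)
  ultimately have "t * sqn (D d x) \<le> e * (sqn x + t\<^sup>2 * sqn (D d x))"
    using form by metis
  then have "2 * e * (t * sqn (D d x)) \<le> 2 * e * (e * (sqn x + t\<^sup>2 * sqn (D d x)))"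
    using e by (intro mult_left_mono) auto
  moreover have "2 * e * t = 1" using e by (simp add: t_def)
  then have "2 * e * (t * sqn (D d x)) = sqn (D d x)"
    and "2 * e * (e * (sqn x + t\<^sup>2 * sqn (D d x))) = 2 * e\<^sup>2 * sqn x + sqn (D d x) / 2"
    using e by (simp_all add: t_def field_simps power2_eq_square)
  ultimately show ?thesis by (simp add: power_mult_distrib)
qed

text \<open>T - c differs from the scalar d - c by T - d, which costs 2 e by
  \<open>sqn_D_near\<close>. Comparing |d - c| with |z - c| for a point z of \<open>A\<close> costs
  another e, whence 3 e.\<close>

lemma qnorm_D_bounds_cball:
  assumes A: "A \<in> sets borel" and x: "P A x = x" and near: "\<And>z. z \<in> A \<Longrightarrow> cmod (z - d) \<le> e"
    and e: "e > 0" and r: "\<And>z. z \<in> A \<Longrightarrow> r1 \<le> cmod (z - c) \<and> cmod (z - c) \<le> r2"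
  shows "(r1 - 3 * e) * qnorm x \<le> qnorm (D c x)" "qnorm (D c x) \<le> (r2 + 3 * e) * qnorm x"
proof -
  have "(r1 - 3 * e) * qnorm x \<le> qnorm (D c x) \<and> qnorm (D c x) \<le> (r2 + 3 * e) * qnorm x"
  proof (cases "A = {}")
    \<comment> \<open>There is no point of \<open>A\<close> to compare with, but then
      \<open>x\<close> is zero.\<close>
    case True
    then have "x = 0" using x P_empty[of x] by simp
    then show ?thesis by (simp add: qnorm_sqn)
  next
    case False
    then obtain z where z: "z \<in> A" by blast
    have "cmod (z - c) \<le> cmod (z - d) + cmod (d - c)" "cmod (d - c) \<le> cmod (z - d) + cmod (z - c)"
      using norm_triangle_ineq[of "z - d" "d - c"] norm_triangle_ineq4[of "z - c" "z - d"]
      by (auto simp: norm_minus_commute)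
    then have "r1 - e \<le> cmod (d - c)" "cmod (d - c) \<le> r2 + e" using near[OF z] r[OF z] by auto
    then have dc: "(r1 - e) * qnorm x \<le> cmod (d - c) * qnorm x"
      "cmod (d - c) * qnorm x \<le> (r2 + e) * qnorm x"
      by (auto intro: mult_right_mono)
    have n: "qnorm (cmult i x (d - c)) = cmod (d - c) * qnorm x"
      by (simp add: qnorm_sqn sqn_cmult real_sqrt_mult)
    have "sqrt (sqn (D d x)) \<le> sqrt ((2 * e)\<^sup>2 * sqn x)"
      by (intro real_sqrt_le_mono sqn_D_near[OF A x _ e] near)
    then have D: "qnorm (D d x) \<le> 2 * e * qnorm x"
      using e by (simp add: qnorm_sqn real_sqrt_mult)
    have "qnorm (D c x) \<le> qnorm (D d x) + qnorm (cmult i x (d - c))"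
      using D_shift[of c x d] qnorm_triangle by simp
    moreover have "cmult i x (d - c) = D c x + - D d x" using D_shift[of c x d] by simp
    then have "qnorm (cmult i x (d - c)) \<le> qnorm (D c x) + qnorm (D d x)"
      using qnorm_triangle[of "D c x" "- D d x"] by (simp add: qnorm_minus)
    ultimately show ?thesis using D dc n by (simp add: algebra_simps)
  qed
  then show "(r1 - 3 * e) * qnorm x \<le> qnorm (D c x)" "qnorm (D c x) \<le> (r2 + 3 * e) * qnorm x"
    by auto
qed

text \<open>Cutting the support into pieces of radius e is harmless because squared norms add up over
  disjoint pieces; thus the factor 2 above disappears in the limit.\<close>

lemma sqn_D_bounds_cover:
  assumes "finite K" "e > 0" "r2 \<ge> 0"
    and "A \<in> sets borel" "P A x = x" "A \<subseteq> (\<Union>d\<in>K. cball d e)"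
    and "\<And>z. z \<in> A \<Longrightarrow> r1 \<le> cmod (z - c) \<and> cmod (z - c) \<le> r2"
  shows "(max 0 (r1 - 3 * e))\<^sup>2 * sqn x \<le> sqn (D c x) \<and> sqn (D c x) \<le> (r2 + 3 * e)\<^sup>2 * sqn x"
  using assms
proof (induction K arbitrary: A x rule: finite_induct)
  case empty
  then have "x = 0" using P_empty[of x] by simp
  then show ?case by simp
next
  case (insert d K)
  \<comment> \<open>Truncation at 0 lets the lower bound survive squaring.\<close>
  let ?m = "max 0 (r1 - 3 * e)"
  let ?B = "cball d e"
  let ?y = "P ?B x"
  let ?z = "P (- ?B) x"
  have B: "?B \<in> sets borel" "- ?B \<in> sets borel" by auto
  have yz: "P (A \<inter> ?B) ?y = ?y" "P (A \<inter> - ?B) ?z = ?z"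
    using insert.prems(3,4) B by (intro P_Int_P; simp)+
  have "(r1 - 3 * e) * qnorm ?y \<le> qnorm (D c ?y)" "qnorm (D c ?y) \<le> (r2 + 3 * e) * qnorm ?y"
    using insert.prems B
    by (intro qnorm_D_bounds_cball[OF _ yz(1), of d]; auto simp: dist_norm norm_minus_commute)+
  then have "?m * qnorm ?y \<le> qnorm (D c ?y)" "qnorm (D c ?y) \<le> (r2 + 3 * e) * qnorm ?y"
    by (auto simp: max_def)
  then have "(?m * qnorm ?y)\<^sup>2 \<le> (qnorm (D c ?y))\<^sup>2"
    "(qnorm (D c ?y))\<^sup>2 \<le> ((r2 + 3 * e) * qnorm ?y)\<^sup>2"
    by (auto intro!: power_mono)
  then have y: "?m\<^sup>2 * sqn ?y \<le> sqn (D c ?y)" "sqn (D c ?y) \<le> (r2 + 3 * e)\<^sup>2 * sqn ?y"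
    by (auto simp: power_mult_distrib qnorm_power2)
  have "?m\<^sup>2 * sqn ?z \<le> sqn (D c ?z) \<and> sqn (D c ?z) \<le> (r2 + 3 * e)\<^sup>2 * sqn ?z"
  proof (rule insert.IH[OF _ _ _ yz(2)])
    show "A \<inter> - ?B \<in> sets borel" using insert.prems(3) B by auto
    show "A \<inter> - ?B \<subseteq> (\<Union>d\<in>K. cball d e)" using insert.prems(5) by blast
  qed (use insert.prems in auto)
  with y show ?case
    by (simp add: sqn_split[OF B(1), of x] sqn_D_split[OF B(1), of c x] distrib_left)
qed

lemma sqn_D_bounds:
  assumes A: "A \<in> sets borel" "bounded A" and x: "P A x = x" and e: "e > 0" and "r2 \<ge> 0"
    and r: "\<And>z. z \<in> A \<Longrightarrow> r1 \<le> cmod (z - c) \<and> cmod (z - c) \<le> r2"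
  shows "(max 0 (r1 - 3 * e))\<^sup>2 * sqn x \<le> sqn (D c x) \<and> sqn (D c x) \<le> (r2 + 3 * e)\<^sup>2 * sqn x"
proof -
  have "compact (closure A)" using A(2) by simp
  then obtain K where "finite K" "closure A \<subseteq> (\<Union>d\<in>K. ball d e)"
    using e unfolding compact_eq_totally_bounded by blast
  then have "A \<subseteq> (\<Union>d\<in>K. cball d e)" using closure_subset[of A] ball_subset_cball by blast
  with sqn_D_bounds_cover[OF \<open>finite K\<close> e \<open>r2 \<ge> 0\<close> A(1) x] r show ?thesis by blast
qed

section \<open>Growth of the powers of T - c and disc projections\<close>

lemma sqn_D_funpow_upper:
  assumes "P (cball c r) x = x" "0 \<le> r" "r < s"
  shows "sqn ((D c ^^ n) x) \<le> (s\<^sup>2) ^ n * sqn x"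
proof (induction n)
  case (Suc n)
  have "P (cball c r) ((D c ^^ n) x) = (D c ^^ n) x" using assms by (simp add: P_D_funpow)
  \<comment> \<open>The piece size (s - r) / 3 makes the error 3 e exactly the gap between the
    radius and the rate.\<close>
  then have "sqn (D c ((D c ^^ n) x)) \<le> (r + 3 * ((s - r) / 3))\<^sup>2 * sqn ((D c ^^ n) x)"
    using sqn_D_bounds[of "cball c r" "(D c ^^ n) x" "(s - r) / 3" r 0 c] assms
    by (auto simp: dist_norm norm_minus_commute)
  also have "r + 3 * ((s - r) / 3) = s" by (simp add: field_simps)
  also have "s\<^sup>2 * sqn ((D c ^^ n) x) \<le> s\<^sup>2 * ((s\<^sup>2) ^ n * sqn x)"
    using Suc.IH by (simp add: mult_left_mono)
  finally show ?case by simp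
qed simp

lemma sqn_D_funpow_lower:
  assumes A: "A \<in> sets borel" "bounded A" and x: "P A x = x" and r: "\<And>z. z \<in> A \<Longrightarrow> r \<le> cmod (z - c)"
    and s: "0 \<le> s" "s < r"
  shows "(s\<^sup>2) ^ n * sqn x \<le> sqn ((D c ^^ n) x)"
proof (induction n)
  case (Suc n)
  have "P A ((D c ^^ n) x) = (D c ^^ n) x" using A x by (simp add: P_D_funpow)
  \<comment> \<open>\<open>sqn_D_bounds\<close> also asks for a nonnegative outer radius, which
    boundedness of \<open>A\<close> supplies.\<close>
  moreover obtain b where "\<forall>z\<in>A. dist c z \<le> b" using A(2) bounded_any_center by metis
  then have "r \<le> cmod (z - c) \<and> cmod (z - c) \<le> max 0 b" if "z \<in> A" for z
    using that r[OF that] by (simp add: dist_norm norm_minus_commute[of z c] le_max_iff_disj)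
  moreover have "(r - s) / 3 > 0" "0 \<le> max 0 b" using s by auto
  ultimately have "(max 0 (r - 3 * ((r - s) / 3)))\<^sup>2 * sqn ((D c ^^ n) x) \<le> sqn (D c ((D c ^^ n) x))"
    using sqn_D_bounds[OF A] by blast
  moreover have "max 0 (r - 3 * ((r - s) / 3)) = s" using s by (simp add: field_simps)
  ultimately have "s\<^sup>2 * sqn ((D c ^^ n) x) \<le> sqn (D c ((D c ^^ n) x))" by metis
  moreover have "s\<^sup>2 * ((s\<^sup>2) ^ n * sqn x) \<le> s\<^sup>2 * sqn ((D c ^^ n) x)"
    using Suc.IH by (intro mult_left_mono) auto
  ultimately show ?case by simp
qed simp

text \<open>A nonzero component on \<open>A\<close> would grow at least at every rate below
  \<open>r\<close>, while the projection does not increase norms and \<open>y\<close> grows at rate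
  \<open>s\<close> at most.\<close>

lemma P_eq_0_if_growth:
  assumes A: "A \<in> sets borel" "bounded A" and r: "\<And>z. z \<in> A \<Longrightarrow> r \<le> cmod (z - c)"
    and s: "0 \<le> s" "s < r" and growth: "\<And>n. sqn ((D c ^^ n) y) \<le> (s\<^sup>2) ^ n * M"
  shows "P A y = 0"
proof -
  \<comment> \<open>Strictly between the two rates: below \<open>r\<close> for the lower estimate,
    above \<open>s\<close> so that the quotient has powers tending to 0.\<close>
  define t where "t = (s + r) / 2"
  have t: "0 < t" "s < t" "t < r" using s by (auto simp: t_def)
  have "sqn (P A y) \<le> (s\<^sup>2 / t\<^sup>2) ^ n * M" for n
  proof -
    have "(t\<^sup>2) ^ n * sqn (P A y) \<le> sqn ((D c ^^ n) (P A y))"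
      using t by (intro sqn_D_funpow_lower[OF A P_idem[OF A(1)] r]) simp_all
    also have "\<dots> = sqn (P A ((D c ^^ n) y))" using A by (simp add: P_D_funpow)
    also have "\<dots> \<le> sqn ((D c ^^ n) y)"
      using sqn_split[OF A(1), of "(D c ^^ n) y"] sqn_nonneg[of "P (- A) ((D c ^^ n) y)"] by linarith
    also have "\<dots> \<le> (s\<^sup>2) ^ n * M" by (rule growth)
    finally show ?thesis using t by (simp add: power_divide field_simps)
  qed
  moreover have "s\<^sup>2 / t\<^sup>2 < 1" using s t by (simp add: power_strict_mono)
  then have "(\<lambda>n. (s\<^sup>2 / t\<^sup>2) ^ n * M) \<longlonglongrightarrow> 0"
    by (intro tendsto_mult_left_zero LIMSEQ_realpow_zero) auto
  ultimately have "sqn (P A y) \<le> 0"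
    by (intro tendsto_lowerbound[of _ 0 sequentially]) auto
  then show ?thesis using sqn_nonneg[of "P A y"] sqn_eq_0 by (metis order_antisym)
qed

text \<open>Additivity needs disjoint sets; the disjointed pieces lie inside the \<open>A n\<close>,
  so their projections annihilate \<open>y\<close> as well.\<close>

lemma P_UN_eq_0:
  assumes A: "\<And>n::nat. A n \<in> sets borel" and 0: "\<And>n. P (A n) y = 0"
  shows "P (\<Union>n. A n) y = 0"
proof -
  have B: "disjointed A n \<in> sets borel" for n
    using sets.range_disjointed_sets[of A borel] A by blast
  have "P (disjointed A n) y = 0" for n
  proof -
    have "P (disjointed A n) y = P (disjointed A n \<inter> A n) y"
      using disjointed_subset[of A n] by (simp add: Int_absorb2)
    also have "\<dots> = 0" by (simp add: P_Int[OF B A] 0 B)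
    finally show ?thesis .
  qed
  then have "(\<lambda>n. qnorm (0 - P (\<Union>n. disjointed A n) y)) \<longlonglongrightarrow> 0"
    using P_countably_additive[OF B disjoint_family_disjointed, of y] by simp
  moreover have "(\<lambda>n. qnorm (0 - 0)) \<longlonglongrightarrow> 0" by (simp add: qnorm_sqn)
  ultimately show ?thesis
    unfolding UN_disjointed_eq by (rule qnorm_limit_unique)
qed

lemma P_cball_if_growth:
  assumes "0 \<le> r" and growth: "\<And>s n. r < s \<Longrightarrow> sqn ((D c ^^ n) y) \<le> (s\<^sup>2) ^ n * M"
  shows "P (cball c r) y = y"
proof -
  \<comment> \<open>The annuli exhaust the complement of the disc. The outer radius keeps them
    bounded, as the lower estimate requires, and the inner one keeps a positive distance from
    \<open>r\<close>.\<close>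
  define A where "A n = cball c (real n) - ball c (r + 1 / real (Suc n))" for n
  have A: "A n \<in> sets borel" for n by (auto simp: A_def)
  have "P (A n) y = 0" for n
  proof (rule P_eq_0_if_growth[OF A])
    show "bounded (A n)" by (auto simp: A_def intro: bounded_subset[OF bounded_cball])
    show "r + 1 / real (Suc n) \<le> cmod (z - c)" if "z \<in> A n" for z
      using that by (auto simp: A_def dist_norm norm_minus_commute)
    \<comment> \<open>The next inner radius serves as the rate: it lies strictly between
      \<open>r\<close> and the current one.\<close>
    show "sqn ((D c ^^ m) y) \<le> ((r + 1 / real (Suc (Suc n)))\<^sup>2) ^ m * M" for m
      by (rule growth) simp
    show "r + 1 / real (Suc (Suc n)) < r + 1 / real (Suc n)" by (simp add: field_simps)
  qed (use assms in simp)
  then have "P (\<Union>n. A n) y = 0" by (rule P_UN_eq_0[OF A])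
  moreover have "(\<Union>n. A n) = - cball c r"
  proof (intro equalityI subsetI)
    fix z assume "z \<in> - cball c r"
    then have z: "dist c z > r" by simp
    obtain n1 where n1: "1 / real (Suc n1) < dist c z - r"
      using z nat_approx_posE[of "dist c z - r"] by auto
    obtain n2 where n2: "dist c z \<le> real n2" using real_arch_simple by blast
    let ?n = "max n1 n2"
    have "1 / real (Suc ?n) \<le> 1 / real (Suc n1)" by (intro divide_left_mono) auto
    then have "z \<in> A ?n" using n1 n2 by (auto simp: A_def)
    then show "z \<in> (\<Union>n. A n)" by blast
  next
    fix z assume "z \<in> (\<Union>n. A n)"
    then obtain n where "z \<in> A n" by blast
    then have "r + 1 / real (Suc n) \<le> dist c z" by (simp add: A_def)
    moreover have "1 / real (Suc n) > 0" by simp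
    ultimately have "r < dist c z" by linarith
    then show "z \<in> - cball c r" by simp
  qed
  ultimately show ?thesis using P_compl[of "cball c r" y] by simp
qed

end

section \<open>Right multiplication by a quaternion anticommuting with \<open>i\<close>\<close>

locale quat_spectral_anticommuting = quat_spectral rmult qinner i T E
  for rmult :: "'h::ab_group_add \<Rightarrow> quat \<Rightarrow> 'h" and qinner i T E +
  fixes w :: quat
  assumes w_imaginary: "qRe w = 0" and w_anticommutes: "w * i = - (i * w)"
begin

lemma ip_rmult_w_left: "ip (rmult x w) y = - ip x (rmult y w)"
proof -
  have "qcnj w = - w" using w_imaginary by (simp add: quat_ops)
  then show ?thesis by (simp add: ip_rmult_left rmult_minus_right ip_linear)
qed

lemma rmult_cmult_w: "rmult (cmult i x c) w = cmult i (rmult x w) (cnj c)"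
proof -
  have "w * cplx_to_quat i (cnj c) = qreal (Re c) * w - qreal (Im c) * (w * i)"
    by (simp add: quat_ops algebra_simps)
  also have "\<dots> = cplx_to_quat i c * w"
    unfolding w_anticommutes by (simp add: quat_ops algebra_simps)
  finally show ?thesis by (simp add: cmult_def rmult_assoc[symmetric])
qed

lemma rmult_D_w: "rmult (D c x) w = D (cnj c) (rmult x w)"
  by (simp add: D_def rmult_diff_left rmult_cmult_w T_rmult)

lemma rmult_D_funpow_w: "rmult ((D c ^^ n) x) w = (D (cnj c) ^^ n) (rmult x w)"
  by (induction n) (auto simp: rmult_D_w)

lemma P_cball_rmult_w_P_cball:
  "P (cball (cnj c) r) (rmult (P (cball c r) x) w) = rmult (P (cball c r) x) w"
proof (cases "r \<ge> 0")
  case True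
  let ?x = "P (cball c r) x"
  let ?m = "(qRe w)\<^sup>2 + (qI w)\<^sup>2 + (qJ w)\<^sup>2 + (qK w)\<^sup>2"
  show ?thesis
  proof (rule P_cball_if_growth[OF True])
    fix s n assume "r < s"
    then have "sqn ((D c ^^ n) ?x) \<le> (s\<^sup>2) ^ n * sqn ?x"
      using True by (intro sqn_D_funpow_upper) (auto simp: P_idem)
    then have "?m * sqn ((D c ^^ n) ?x) \<le> ?m * ((s\<^sup>2) ^ n * sqn ?x)"
      by (intro mult_left_mono) auto
    then show "sqn ((D (cnj c) ^^ n) (rmult ?x w)) \<le> (s\<^sup>2) ^ n * (?m * sqn ?x)"
      unfolding rmult_D_funpow_w[symmetric] ip_rmult_rmult by (simp only: mult.left_commute)
  qed
\<comment> \<open>For negative \<open>r\<close> both discs are empty and both sides are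
  zero.\<close>
qed simp

text \<open>It remains to kill the image of the component \<open>?u\<close> outside the disc. The
  inclusion of ranges, applied from the conjugate disc back to the original one, sends
  \<open>?a\<close> to a vector orthogonal to \<open>?u\<close>. As \<open>w\<close> is skew for
  \<open>ip\<close>, this orthogonality says |?a|^2 = 0.\<close>

lemma P_cball_rmult_w: "P (cball (cnj c) r) (rmult x w) = rmult (P (cball c r) x) w"
proof -
  let ?B = "cball c r" and ?B' = "cball (cnj c) r"
  let ?u = "x - P ?B x"
  let ?a = "P ?B' (rmult ?u w)"
  have "sqn ?a = ip (rmult ?u w) (P ?B' ?a)" by (simp add: P_ip)
  also have "\<dots> = - ip ?u (rmult (P ?B' ?a) w)" by (rule ip_rmult_w_left)
  also have "rmult (P ?B' ?a) w = P ?B (rmult (P ?B' ?a) w)"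
    using P_cball_rmult_w_P_cball[of "cnj c" r ?a] by simp
  also have "ip ?u \<dots> = ip (P ?B ?u) (rmult (P ?B' ?a) w)" by (simp add: P_ip)
  also have "P ?B ?u = 0" by (simp add: P_diff P_idem)
  finally have "?a = 0" by simp
  then have "P ?B' (rmult x w) = P ?B' (rmult (P ?B x) w)" by (simp add: rmult_diff_left P_diff)
  then show ?thesis by (simp add: P_cball_rmult_w_P_cball)
qed

lemma P_rmult_w:
  assumes "A \<in> sets borel"
  shows "P (cnj -` A) (rmult x w) = rmult (P A x) w"
proof -
  define G where "G = {A \<in> sets borel. \<forall>x. P (cnj -` A) (rmult x w) = rmult (P A x) w}"
  \<comment> \<open>Multiplicativity of \<open>P\<close> handles intersections. Once
    \<open>G\<close> is an algebra, only disjoint countable unions remain, where the additivity of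
    \<open>P\<close> applies.\<close>
  have "algebra UNIV G"
    unfolding algebra_iff_Int
  proof (intro conjI ballI)
    show "UNIV - A \<in> G" if "A \<in> G" for A
      using that
      by (auto simp: G_def Compl_eq_Diff_UNIV[symmetric] vimage_Compl P_compl vimage_cnj_borel
          rmult_diff_left)
    show "A \<inter> B \<in> G" if "A \<in> G" "B \<in> G" for A B
      using that by (auto simp: G_def P_Int vimage_cnj_borel)
  qed (auto simp: G_def)
  moreover have "(\<Union>n. A n) \<in> G" if A: "range A \<subseteq> G" "disjoint_family A" for A :: "nat \<Rightarrow> complex set"
  proof -
    have b: "A n \<in> sets borel" and c: "P (cnj -` A n) (rmult x w) = rmult (P (A n) x) w" for n x
      using A(1) by (auto simp: G_def)
    have "P (\<Union>n. cnj -` A n) (rmult x w) = rmult (P (\<Union>n. A n) x) w" for x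
    proof (rule qnorm_limit_unique)
      have "disjoint_family (\<lambda>n. cnj -` A n)"
        using A(2) by (auto simp: disjoint_family_on_def)
      then show "(\<lambda>n. qnorm ((\<Sum>k<n. P (cnj -` A k) (rmult x w))
          - P (\<Union>n. cnj -` A n) (rmult x w))) \<longlonglongrightarrow> 0"
        using b by (intro P_countably_additive vimage_cnj_borel)
      let ?m = "(qRe w)\<^sup>2 + (qI w)\<^sup>2 + (qJ w)\<^sup>2 + (qK w)\<^sup>2"
      \<comment> \<open>Right multiplication by \<open>w\<close> scales norms by |w|, so it carries
        the convergent partial sums to convergent ones.\<close>
      have "(\<lambda>n. sqrt ?m * qnorm ((\<Sum>k<n. P (A k) x) - P (\<Union>n. A n) x)) \<longlonglongrightarrow> 0"
        using P_countably_additive[OF b A(2)] by (rule tendsto_mult_right_zero)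
      then show "(\<lambda>n. qnorm ((\<Sum>k<n. P (cnj -` A k) (rmult x w))
          - rmult (P (\<Union>n. A n) x) w)) \<longlonglongrightarrow> 0"
        unfolding c rmult_sum[symmetric] rmult_diff_left[symmetric]
        by (simp only: qnorm_sqn ip_rmult_rmult real_sqrt_mult)
    qed
    then show ?thesis using b by (auto simp: G_def vimage_UN)
  qed
  ultimately interpret G: sigma_algebra UNIV G
    by (simp add: sigma_algebra_disjoint_iff)
  have "S \<in> G" if S: "open S" for S
  proof -
    obtain F where F: "countable F" "\<And>B. B \<in> F \<Longrightarrow> \<exists>c r. B = cball c r" "S = \<Union>F"
      using open_eq_countable_Union_cballs[OF S] by metis
    have "cball c r \<in> G" for c r
      by (simp add: G_def vimage_cnj_cball P_cball_rmult_w)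
    then have "F \<subseteq> G" using F(2) by fast
    then show ?thesis using F(1,3) G.countable_Union by blast
  qed
  then have "sigma_sets UNIV {S. open S} \<subseteq> G" by (intro G.sigma_sets_subset) auto
  then have "sets borel \<subseteq> G" by (simp add: borel_def)
  then show ?thesis using assms by (auto simp: G_def)
qed

end

section \<open>Symmetric sets and arbitrary quaternions\<close>

theorem mainTheorem4:
  fixes rmult :: "'h::ab_group_add \<Rightarrow> quat \<Rightarrow> 'h"
    and qinner :: "'h \<Rightarrow> 'h \<Rightarrow> quat"
    and T :: "'h \<Rightarrow> 'h"
    and i :: quat
    and E :: "complex set \<Rightarrow> 'h \<Rightarrow> 'h"
    and \<omega> :: "complex set"
  assumes "quat_hilbert rmult qinner"
    and "T \<in> quat_hilbert.BR rmult qinner"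
    and "quat_hilbert.normal_op qinner T"
    and "i \<in> qS"
    and "quat_hilbert.spectral_measure_of rmult qinner i T E"
    and "\<omega> \<in> sets borel"
    and "\<omega> \<subseteq> quat_hilbert.spectrum_i rmult qinner i T"
    and "\<forall>z\<in>\<omega>. cnj z \<in> \<omega>"
  shows "E \<omega> \<in> quat_hilbert.BR rmult qinner"
proof -
  interpret quat_hilbert rmult qinner by fact
  interpret quat_spectral rmult qinner i T E
    using assms(2,4,5) by unfold_locales (auto simp: BR_def)
  have E: "E \<omega> = P \<omega>" using assms(7) by (simp add: P_def Int_absorb1)
  have sym: "cnj -` \<omega> = \<omega>"
  proof (intro equalityI subsetI)
    fix z assume "z \<in> cnj -` \<omega>"
    then have "cnj (cnj z) \<in> \<omega>" using assms(8) by blast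
    then show "z \<in> \<omega>" by simp
  qed (use assms(8) in auto)
  have "P \<omega> (rmult x q) = rmult (P \<omega> x) q" for x q
  proof -
    obtain z w where q: "q = cplx_to_quat i z + w" and w: "qRe w = 0" "w * i = - (i * w)"
      by (rule quat_split_anticommuting[OF assms(4)])
    \<comment> \<open>The anticommuting part depends on \<open>q\<close>, so the locale is entered
      separately for each quaternion.\<close>
    interpret quat_spectral_anticommuting rmult qinner i T E w
      using w by unfold_locales
    have "P \<omega> (rmult x w) = rmult (P \<omega> x) w" using P_rmult_w[OF assms(6)] sym by simp
    then show ?thesis
      using P_cmult[OF assms(6), of x z]
      by (simp add: q rmult_add_right P_add[OF assms(6)] cmult_def)
  qed
  then have "right_linear (E \<omega>)"
    unfolding E by (intro right_linearI P_add[OF assms(6)])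
  moreover have "bounded_op (E \<omega>)"
    using P_orth_proj[OF assms(6)] by (simp add: E orth_proj_i_def)
  ultimately show ?thesis by (simp add: BR_def)
qed

end
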